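(* Let $f:\mathbb{D}\to\mathbb{D}$ be holomorphic and let $\sigma\in\partial\mathbb{D}$ be such that $\beta_f(\sigma)<+\infty$. Then $$\beta_{\Delta_w f}(\sigma)=\beta_f(\sigma)\,\frac{1-|f(w)|^2}{|f(\sigma)-f(w)|^2}-\frac{1-|w|^2}{|\sigma-w|^2}$$ for all $w\in\mathbb{D}$. In particular, $\beta_{\Delta_{w_0}f}(\sigma)<+\infty$ for some $w_0\in\mathbb{D}$ if and only if $\beta_{\Delta_w f}(\sigma)<+\infty$ for all $w\in\mathbb{D}$ if and only if $\beta_f(\sigma)<+\infty$.
   Context: $\mathbb{D}=\{z\in\mathbb{C}:|z|<1\}$ is the unit disk and $\partial\mathbb{D}$ the unit circle. For a holomorphic map $g:\mathbb{D}\to\overline{\mathbb{D}}$ and $\sigma\in\partial\mathbb{D}$, the boundary dilation coefficient is $\beta_g(\sigma)=\liminf_{z\to\sigma}\frac{1-|g(z)|}{1-|z|}\in[0,+\infty]$ ($z\in\mathbb{D}$). If $f:\mathbb{D}\to\mathbb{D}$ is holomorphic and $\beta_f(\sigma)<+\infty$, then $f$ has a non-tangential limit at $\sigma$ (limit as $z\to\sigma$ inside each Stolz region $\{z\in\mathbb{D}:|\sigma-z|<M(1-|z|)\}$, $M>1$), which belongs to $\partial\mathbb{D}$ and is denoted $f(\sigma)$. For $f:\mathbb{D}\to\mathbb{D}$ holomorphic and $w\in\mathbb{D}$, the hyperbolic difference quotient $\Delta_w f:\mathbb{D}\to\overline{\mathbb{D}}$ is the holomorphic function $\Delta_w f(z)=f^*(z,w)$,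 where $$f^*(z,w)=\frac{f(z)-f(w)}{1-\overline{f(w)}f(z)}\bigg/\frac{z-w}{1-\overline{w}z}\quad (z\neq w),\qquad f^*(w,w)=f'(w)\frac{1-|w|^2}{1-|f(w)|^2}.$$ *)

theory Defs
  imports "HOL-Complex_Analysis.Complex_Analysis"
begin

definition boundary_dilation :: "(complex \<Rightarrow> complex) \<Rightarrow> complex \<Rightarrow> ereal" where
  "boundary_dilation g \<sigma> =
     Liminf (at \<sigma> within ball 0 1) (\<lambda>z. ereal ((1 - norm (g z)) / (1 - norm z)))"

definition stolz_region :: "complex \<Rightarrow> real \<Rightarrow> complex set" where
  "stolz_region \<sigma> M = {z \<in> ball 0 1. norm (\<sigma> - z) < M * (1 - norm z)}"

definition has_nontangential_limit :: "(complex \<Rightarrow> complex) \<Rightarrow> complex \<Rightarrow> complex \<Rightarrow> bool" where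
  "has_nontangential_limit f \<sigma> l \<longleftrightarrow>
     (\<forall>M>1. (f \<longlongrightarrow> l) (at \<sigma> within stolz_region \<sigma> M))"

(* The boundary value f(sigma).  It is independent of the value of the HOL function f at the
   point sigma itself, and it is unspecified if there is no non-tangential limit. *)
definition nontangential_limit :: "(complex \<Rightarrow> complex) \<Rightarrow> complex \<Rightarrow> complex" where
  "nontangential_limit f \<sigma> = (THE l. has_nontangential_limit f \<sigma> l)"

definition hyperbolic_quotient ::
    "(complex \<Rightarrow> complex) \<Rightarrow> complex \<Rightarrow> complex \<Rightarrow> complex" where
  "hyperbolic_quotient f w z =
     (if z = w
      then deriv f w * of_real ((1 - (norm w)\<^sup>2) / (1 - (norm (f w))\<^sup>2))
      else ((f z - f w) / (1 - cnj (f w) * f z)) / ((z - w) / (1 - cnj w * z)))"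

end

theory Submission
  imports Defs
begin

text \<open>
  The quotient \<open>(1 - \<bar>h(z)\<bar>) / (1 - \<bar>z\<bar>)\<close> may be replaced by its squared variant
  \<open>R\<^sub>h(z) = (1 - \<bar>h(z)\<bar>\<^sup>2) / (1 - \<bar>z\<bar>\<^sup>2)\<close> in the definition of the boundary dilation coefficient:
  the two differ by the factor \<open>(1 + \<bar>h(z)\<bar>) / (1 + \<bar>z\<bar>)\<close>, which tends to \<open>1\<close> wherever
  one of them stays bounded. The gain is that \<open>R\<close> obeys an exact identity. Write \<open>g\<close> for the
  hyperbolic difference quotient of \<open>f\<close> at \<open>w\<close>. From
  \<open>\<bar>1 - cnj a * z\<bar>\<^sup>2 - \<bar>z - a\<bar>\<^sup>2 = (1 - \<bar>a\<bar>\<^sup>2) (1 - \<bar>z\<bar>\<^sup>2)\<close>, used once in the domain and once in the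
  range of \<open>f\<close>, one gets \<open>T(z) R\<^sub>g(z) = A(z) R\<^sub>f(z) - B(z)\<close> with
  \<open>T(z) = \<bar>z - w\<bar>\<^sup>2 / \<bar>1 - cnj w * z\<bar>\<^sup>2\<close>,
  \<open>A(z) = (1 - \<bar>f(w)\<bar>\<^sup>2) / \<bar>1 - cnj (f(w)) * f(z)\<bar>\<^sup>2\<close> and
  \<open>B(z) = (1 - \<bar>w\<bar>\<^sup>2) / \<bar>1 - cnj w * z\<bar>\<^sup>2\<close>
  (lemma \<open>defect_ratio_hyperbolic_quotient\<close>).

  As \<open>z\<close> tends to \<open>\<sigma>\<close>, \<open>T\<close> tends to \<open>1\<close> and \<open>B\<close> to the subtracted term of the formula. The
  factor \<open>A\<close> is bounded below by a positive constant, so a bound on \<open>R\<^sub>g\<close> entails one on \<open>R\<^sub>f\<close>; hence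
  finiteness for one \<open>w\<close> implies finiteness for \<open>f\<close>, and the formula gives the converse for every \<open>w\<close>.
  For the formula itself
  \<open>f(z)\<close> must approach the non-tangential limit \<open>f(\<sigma>)\<close> although the lower limit admits tangential
  approach. Julia's inequality
  \<open>\<bar>f(\<sigma>) - f(z)\<bar>\<^sup>2 \<le> C \<bar>\<sigma> - z\<bar>\<^sup>2 R\<^sub>f(z)\<close>, obtained from Schwarz-Pick by letting one of the two
  points run to \<open>\<sigma>\<close>, settles this: where \<open>R\<^sub>f\<close> is bounded, the right-hand side tends to \<open>0\<close>.
  Points where \<open>R\<^sub>f\<close> is large do not affect a finite lower limit.
\<close>

section \<open>Lower limits of functions that are close on sublevel sets\<close>

text \<open>
  A lower limit only sees the points where the function is not much larger than the lower limit.
  Hence closeness of two functions is required only on the sets where \<open>u\<close> is bounded.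
\<close>

lemma Liminf_le_if_close_on_sublevels:
  fixes u v :: "'a \<Rightarrow> real"
  assumes "\<And>C. ((\<lambda>x. v x - u x) \<longlongrightarrow> 0) (inf F (principal {x. u x \<le> C}))"
  shows "Liminf F (\<lambda>x. ereal (v x)) \<le> Liminf F (\<lambda>x. ereal (u x))"
proof (rule ccontr)
  assume "\<not> ?thesis"
  then obtain a where a: "Liminf F (\<lambda>x. ereal (u x)) < ereal a" "ereal a < Liminf F (\<lambda>x. ereal (v x))"
    using ereal_dense2 by (metis not_le)
  then obtain b where b: "ereal a < ereal b" "ereal b < Liminf F (\<lambda>x. ereal (v x))"
    using ereal_dense2 by metis
  have "\<forall>\<^sub>F x in inf F (principal {x. u x \<le> a}). \<bar>v x - u x\<bar> < b - a"
    using tendstoD[OF assms[of a], of "b - a"] b(1) by (simp add: dist_real_def)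
  then have "\<forall>\<^sub>F x in F. u x \<le> a \<longrightarrow> \<bar>v x - u x\<bar> < b - a"
    by (simp add: eventually_inf_principal)
  with less_LiminfD[OF b(2)] have "\<forall>\<^sub>F x in F. ereal a \<le> ereal (u x)"
    by eventually_elim auto
  then have "ereal a \<le> Liminf F (\<lambda>x. ereal (u x))"
    by (rule Liminf_bounded)
  with a(1) show False by simp
qed

text \<open>
  The second hypothesis transfers the closeness to the sublevel sets of \<open>v\<close>, so that the previous
  lemma applies in both directions.
\<close>
lemma Liminf_eq_if_close_on_sublevels:
  fixes u v :: "'a \<Rightarrow> real"
  assumes close: "\<And>C. ((\<lambda>x. v x - u x) \<longlongrightarrow> 0) (inf F (principal {x. u x \<le> C}))"
    and bounded: "\<And>C. \<exists>C'. \<forall>\<^sub>F x in F. v x \<le> C \<longrightarrow> u x \<le> C'"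
  shows "Liminf F (\<lambda>x. ereal (v x)) = Liminf F (\<lambda>x. ereal (u x))"
proof (rule antisym)
  show "Liminf F (\<lambda>x. ereal (v x)) \<le> Liminf F (\<lambda>x. ereal (u x))"
    using close by (rule Liminf_le_if_close_on_sublevels)
  show "Liminf F (\<lambda>x. ereal (u x)) \<le> Liminf F (\<lambda>x. ereal (v x))"
  proof (rule Liminf_le_if_close_on_sublevels)
    fix C
    obtain C' where C': "\<forall>\<^sub>F x in F. v x \<le> C \<longrightarrow> u x \<le> C'"
      using bounded by blast
    have "inf F (principal {x. v x \<le> C}) \<le> inf F (principal {x. u x \<le> C'})"
      using C' by (simp add: le_principal eventually_inf_principal)
    then have "((\<lambda>x. v x - u x) \<longlongrightarrow> 0) (inf F (principal {x. v x \<le> C}))"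
      by (rule tendsto_mono) (rule close)
    from tendsto_minus[OF this]
    show "((\<lambda>x. u x - v x) \<longlongrightarrow> 0) (inf F (principal {x. v x \<le> C}))"
      by simp
  qed
qed

lemma Liminf_less_PInfty_iff:
  fixes u :: "'a \<Rightarrow> real"
  shows "Liminf F (\<lambda>x. ereal (u x)) < \<infinity> \<longleftrightarrow> (\<exists>C. \<exists>\<^sub>F x in F. u x \<le> C)"
proof
  assume "Liminf F (\<lambda>x. ereal (u x)) < \<infinity>"
  then obtain C where C: "Liminf F (\<lambda>x. ereal (u x)) < ereal C"
    using ereal_dense2 by blast
  have "\<exists>\<^sub>F x in F. u x \<le> C"
  proof (rule ccontr)
    assume "\<not> ?thesis"
    then have "\<forall>\<^sub>F x in F. ereal C \<le> ereal (u x)"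
      by (auto simp: not_frequently elim!: eventually_mono)
    then have "ereal C \<le> Liminf F (\<lambda>x. ereal (u x))" by (rule Liminf_bounded)
    with C show False by simp
  qed
  then show "\<exists>C. \<exists>\<^sub>F x in F. u x \<le> C" ..
next
  assume "\<exists>C. \<exists>\<^sub>F x in F. u x \<le> C"
  then obtain C where C: "\<exists>\<^sub>F x in F. u x \<le> C" ..
  show "Liminf F (\<lambda>x. ereal (u x)) < \<infinity>"
  proof (rule ccontr)
    assume "\<not> ?thesis"
    then have "ereal C < Liminf F (\<lambda>x. ereal (u x))" by simp
    from less_LiminfD[OF this] C show False
      by (simp add: frequently_def not_le)
  qed
qed

section \<open>The squared dilation quotient\<close>

definition defect_ratio :: "(complex \<Rightarrow> complex) \<Rightarrow> complex \<Rightarrow> real" where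
  "defect_ratio h z = (1 - (norm (h z))\<^sup>2) / (1 - (norm z)\<^sup>2)"

lemma at_sphere_within_disc_nontrivial:
  fixes \<sigma> :: complex
  assumes "\<sigma> \<in> sphere 0 1"
  shows "at \<sigma> within ball 0 1 \<noteq> bot"
  using assms by (simp add: trivial_limit_within islimpt_ball)

lemma eventually_in_disc: "\<forall>\<^sub>F z in at \<sigma> within ball 0 1. z \<in> ball 0 (1::real)"
  by (simp add: eventually_at_filter)

lemma tendsto_norm_at_sphere:
  fixes \<sigma> :: complex
  assumes "\<sigma> \<in> sphere 0 1"
  shows "(norm \<longlongrightarrow> 1) (at \<sigma> within S)"
  using tendsto_norm[OF tendsto_ident_at, of \<sigma> S] assms by simp

lemma one_minus_norm_square_pos:
  fixes z :: complex
  assumes "z \<in> ball 0 1"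
  shows "0 < 1 - (norm z)\<^sup>2"
  using assms by (simp add: power_less_one_iff abs_square_less_1)

lemma one_minus_cnj_mult_nonzero:
  fixes a z :: complex
  assumes "a \<in> ball 0 1" "norm z \<le> 1"
  shows "1 - cnj a * z \<noteq> 0"
proof
  assume "1 - cnj a * z = 0"
  then have "norm a * norm z = 1"
    by (metis complex_mod_cnj norm_mult norm_one right_minus_eq)
  moreover have "norm a * norm z \<le> norm a * 1"
    using assms by (intro mult_left_mono) auto
  ultimately show False using assms by simp
qed

lemma defect_ratio_nonneg:
  assumes "z \<in> ball 0 1" "norm (h z) \<le> 1"
  shows "0 \<le> defect_ratio h z"
  using assms one_minus_norm_square_pos[of z] by (simp add: defect_ratio_def power_le_one)

text \<open>
  The bound \<open>C\<close> makes \<open>1 - \<bar>h(z)\<bar>\<^sup>2\<close> vanish at least as fast as \<open>1 - \<bar>z\<bar>\<^sup>2\<close>.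
\<close>
lemma norm_tendsto_1_if_defect_ratio_bounded:
  fixes \<sigma> :: complex
  assumes \<sigma>: "\<sigma> \<in> sphere 0 1" 
    and le: "\<forall>\<^sub>F z in at \<sigma> within ball 0 1. norm (h z) \<le> 1"
  shows "((\<lambda>z. norm (h z)) \<longlongrightarrow> 1)
    (inf (at \<sigma> within ball 0 1) (principal {z. defect_ratio h z \<le> C}))" (is "(_ \<longlongrightarrow> _) ?G")
proof (rule tendsto_sandwich)
  have G: "?G \<le> at \<sigma> within ball 0 1" by simp
  have n: "(norm \<longlongrightarrow> 1) ?G"
    using tendsto_mono[OF G tendsto_norm_at_sphere[OF \<sigma>]] .
  have "((\<lambda>z. 1 - C * (1 - (norm z)\<^sup>2)) \<longlongrightarrow> 1 - C * (1 - 1\<^sup>2)) ?G"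
    by (intro tendsto_intros n)
  then show "((\<lambda>z. 1 - C * (1 - (norm z)\<^sup>2)) \<longlongrightarrow> 1) ?G" by simp
  show "\<forall>\<^sub>F z in ?G. norm (h z) \<le> 1" 
    using le G by (rule filter_leD[rotated])
  show "\<forall>\<^sub>F z in ?G. 1 - C * (1 - (norm z)\<^sup>2) \<le> norm (h z)"
    unfolding eventually_inf_principal
    using le eventually_in_disc
  proof eventually_elim
    case (elim z)
    show ?case
    proof
      assume "z \<in> {z. defect_ratio h z \<le> C}"
      then have "1 - (norm (h z))\<^sup>2 \<le> C * (1 - (norm z)\<^sup>2)"
        using one_minus_norm_square_pos[OF elim(2)] by (simp add: defect_ratio_def divide_le_eq)
      moreover have "(norm (h z))\<^sup>2 \<le> norm (h z)"
        using elim(1) by (simp add: power2_eq_square mult_left_le)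
      ultimately show "1 - C * (1 - (norm z)\<^sup>2) \<le> norm (h z)" by simp
    qed
  qed
qed simp

text \<open>
  The quotient \<open>(1 - \<bar>h(z)\<bar>) / (1 - \<bar>z\<bar>)\<close> is the defect ratio times \<open>(1 + \<bar>z\<bar>) / (1 + \<bar>h(z)\<bar>)\<close>. This factor
  tends to \<open>1\<close> where the defect ratio is bounded, and it is at least \<open>1/2\<close>, so a bound on the product
  bounds the defect ratio.
\<close>
lemma boundary_dilation_eq_Liminf_defect_ratio:
  fixes \<sigma> :: complex
  assumes \<sigma>: "\<sigma> \<in> sphere 0 1"
    and le: "\<forall>\<^sub>F z in at \<sigma> within ball 0 1. norm (h z) \<le> 1"
  shows "boundary_dilation h \<sigma> = Liminf (at \<sigma> within ball 0 1) (\<lambda>z. ereal (defect_ratio h z))"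
  unfolding boundary_dilation_def
proof (rule Liminf_eq_if_close_on_sublevels)
  have factor: "(1 - norm (h z)) / (1 - norm z) = defect_ratio h z * ((1 + norm z) / (1 + norm (h z)))"
    if "z \<in> ball 0 1" for z
  proof -
    have *: "1 - (norm x)\<^sup>2 = (1 - norm x) * (1 + norm x)" for x :: complex
      by (simp add: power2_eq_square algebra_simps)
    have "1 + norm x > 0" for x :: complex by (simp add: add_pos_nonneg)
    then have "1 + norm x \<noteq> 0" for x :: complex by (metis less_irrefl)
    then show ?thesis using that unfolding defect_ratio_def *
      by simp
  qed
  fix C :: real
  let ?G = "inf (at \<sigma> within ball 0 1) (principal {z. defect_ratio h z \<le> C})"
  have n: "(norm \<longlongrightarrow> 1) ?G"
    by (rule tendsto_mono[OF _ tendsto_norm_at_sphere[OF \<sigma>]]) (rule inf_le1)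
  have "((\<lambda>z. (1 + norm z) / (1 + norm (h z)) - 1) \<longlongrightarrow> (1 + 1) / (1 + 1) - 1) ?G"
    using assms by (intro tendsto_intros n norm_tendsto_1_if_defect_ratio_bounded) auto
  then have "((\<lambda>z. (1 + norm z) / (1 + norm (h z)) - 1) \<longlongrightarrow> 0) ?G" by simp
  then show "((\<lambda>z. (1 - norm (h z)) / (1 - norm z) - defect_ratio h z) \<longlongrightarrow> 0) ?G"
  proof (rule tendsto_0_le)
    show "\<forall>\<^sub>F z in ?G. norm ((1 - norm (h z)) / (1 - norm z) - defect_ratio h z)
            \<le> norm ((1 + norm z) / (1 + norm (h z)) - 1) * C"
      unfolding eventually_inf_principal
      using le eventually_in_disc
    proof eventually_elim
      case (elim z)
      have "(1 - norm (h z)) / (1 - norm z) - defect_ratio h z =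
          ((1 + norm z) / (1 + norm (h z)) - 1) * defect_ratio h z"
        unfolding factor[OF elim(2)] by (simp add: algebra_simps)
      then show ?case using defect_ratio_nonneg[where h = h, OF elim(2,1)]
        by (auto simp: abs_mult intro: mult_left_mono)
    qed
  qed
  have "\<forall>\<^sub>F z in at \<sigma> within ball 0 1. (1 - norm (h z)) / (1 - norm z) \<le> C \<longrightarrow> defect_ratio h z \<le> 2 * C"
    using le eventually_in_disc
  proof eventually_elim
    case (elim z)
    have "1 \<le> 2 * ((1 + norm z) / (1 + norm (h z)))"
    proof -
      have "1 + norm (h z) \<le> 2 * (1 + norm z)" using elim(1) by (smt (verit) norm_ge_zero)
      moreover have "0 < 1 + norm (h z)" by (simp add: add_pos_nonneg)
      ultimately show ?thesis by (simp add: le_divide_eq)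
    qed
    from mult_left_mono[OF this defect_ratio_nonneg[where h = h, OF elim(2,1)]]
    have "defect_ratio h z \<le> 2 * ((1 - norm (h z)) / (1 - norm z))"
      unfolding factor[OF elim(2)] by (simp add: algebra_simps)
    then show ?case by linarith
  qed
  then show "\<exists>C'. \<forall>\<^sub>F z in at \<sigma> within ball 0 1.
      (1 - norm (h z)) / (1 - norm z) \<le> C \<longrightarrow> defect_ratio h z \<le> C'" by blast
qed

section \<open>The Schwarz-Pick lemma and Julia's inequality\<close>

text \<open>
  Divided by \<open>\<bar>1 - cnj a * z\<bar>\<^sup>2\<close>, this computes \<open>1 - \<bar>\<phi>(z)\<bar>\<^sup>2\<close> for the disc automorphism \<open>\<phi>\<close> that sends
  \<open>a\<close> to \<open>0\<close>.
\<close>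
lemma disc_automorphism_identity:
  fixes a z :: complex
  shows "(norm (1 - cnj a * z))\<^sup>2 - (norm (z - a))\<^sup>2 = (1 - (norm a)\<^sup>2) * (1 - (norm z)\<^sup>2)"
  unfolding cmod_power2 by (simp add: power2_eq_square algebra_simps)

lemma norm_one_minus_cnj_mult_sphere:
  fixes l z :: complex
  assumes "norm l = 1"
  shows "norm (1 - cnj l * z) = norm (l - z)"
proof -
  have "(norm (1 - cnj l * z))\<^sup>2 = (norm (z - l))\<^sup>2"
    using disc_automorphism_identity[of l z] assms by simp
  then show ?thesis by (simp add: norm_minus_commute)
qed

text \<open>
  Conjugating \<open>f\<close> with the disc automorphisms that move \<open>w\<close> and \<open>f(w)\<close> to the origin reduces the claim
  to the Schwarz lemma.
\<close>
theorem Schwarz_Pick: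
  assumes holf: "f holomorphic_on ball 0 1" and im: "f ` ball 0 1 \<subseteq> ball 0 1"
    and z: "z \<in> ball 0 1" and w: "w \<in> ball 0 1"
  shows "norm ((f z - f w) / (1 - cnj (f w) * f z)) \<le> norm ((z - w) / (1 - cnj w * z))"
proof -
  define M where "M = Moebius_function 0"
  have M_norm: "norm (M a x) < 1" if "norm a < 1" "norm x < 1" for a x
    unfolding M_def using that by (rule Moebius_function_norm_lt_1)
  have M_hol: "M a holomorphic_on ball 0 1" if "norm a < 1" for a
    unfolding M_def using that by (rule Moebius_function_holomorphic)
  have fw: "norm (f w) < 1" using im w by (simp add: image_subset_iff)
  have w': "norm w < 1" using w by simp
  define F where "F = M (f w) \<circ> (f \<circ> M (- w))"
  have "F holomorphic_on ball 0 1"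
    unfolding F_def
  proof (intro holomorphic_on_compose_gen)
    show "M (- w) holomorphic_on ball 0 1" using M_hol w' by simp
    show "M (- w) ` ball 0 1 \<subseteq> ball 0 1" using M_norm w' by auto
    show "(f \<circ> M (- w)) ` ball 0 1 \<subseteq> ball 0 1" using M_norm[of "- w"] w' im by (force simp: image_subset_iff)
    show "f holomorphic_on ball 0 1" by (fact holf)
    show "M (f w) holomorphic_on ball 0 1" using M_hol fw by simp
  qed
  moreover have "F 0 = 0" by (simp add: F_def M_def Moebius_function_of_zero Moebius_function_eq_zero)
  moreover have "norm (F x) < 1" if "norm x < 1" for x
    unfolding F_def o_def using M_norm[of "- w" x] w' that im fw by (intro M_norm) (auto simp: image_subset_iff)
  ultimately have "norm (F (M w z)) \<le> norm (M w z)"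
    using M_norm[of w z] w' z by (intro Schwarz_Lemma(1)) auto
  moreover have "M (- w) (M w z) = z"
    unfolding M_def using w' z by (intro Moebius_function_compose) auto
  ultimately show ?thesis
    by (simp add: F_def M_def Moebius_function_simple)
qed

text \<open>
  Unlike the quotient form, this inequality has no denominators. Dividing it by
  \<open>(1 - \<bar>w\<bar>\<^sup>2) (1 - \<bar>z\<bar>\<^sup>2)\<close> brings out the defect ratios at both points, and in this shape it survives
  the passage to the boundary in one of them.
\<close>
lemma Schwarz_Pick_defect_form:
  assumes holf: "f holomorphic_on ball 0 1" and im: "f ` ball 0 1 \<subseteq> ball 0 1"
    and z: "z \<in> ball 0 1" and w: "w \<in> ball 0 1"
  shows "(norm (1 - cnj (f w) * f z))\<^sup>2 * ((1 - (norm w)\<^sup>2) * (1 - (norm z)\<^sup>2))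
     \<le> (norm (1 - cnj w * z))\<^sup>2 * ((1 - (norm (f w))\<^sup>2) * (1 - (norm (f z))\<^sup>2))"
proof -
  let ?p = "norm (1 - cnj (f w) * f z)" and ?q = "norm (1 - cnj w * z)"
  have fz: "f z \<in> ball 0 1" and fw: "f w \<in> ball 0 1" using im z w by blast+
  have "?p > 0" "?q > 0"
    using one_minus_cnj_mult_nonzero[OF fw, of "f z"] one_minus_cnj_mult_nonzero[OF w, of z] fz z by auto
  moreover have "norm (f z - f w) / ?p \<le> norm (z - w) / ?q"
    using Schwarz_Pick[OF assms] by (simp add: norm_divide)
  ultimately have "norm (f z - f w) * ?q \<le> norm (z - w) * ?p"
    by (simp add: field_simps)
  then have "(norm (f z - f w) * ?q)\<^sup>2 \<le> (norm (z - w) * ?p)\<^sup>2"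
    by (intro power_mono) auto
  then show ?thesis
    unfolding disc_automorphism_identity[symmetric] by (simp add: algebra_simps power_mult_distrib)
qed

text \<open>
  The points near \<open>\<sigma>\<close> with defect ratio at most \<open>C\<close> have images that cluster, by compactness, at some
  \<open>l\<close>, and \<open>l\<close> lies on the circle because there the images tend to the circle. Applying Schwarz-Pick
  to \<open>z\<close> and such a point \<open>\<zeta>\<close>, and letting \<open>\<zeta>\<close> tend to \<open>\<sigma>\<close> with \<open>f(\<zeta>)\<close> tending to \<open>l\<close>, gives the
  inequality.
\<close>
lemma Julia_inequality:
  assumes holf: "f holomorphic_on ball 0 1" and im: "f ` ball 0 1 \<subseteq> ball 0 1"
    and \<sigma>: "\<sigma> \<in> sphere 0 1"
    and freq: "\<exists>\<^sub>F z in at \<sigma> within ball 0 1. defect_ratio f z \<le> C"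
  obtains l where "norm l = 1"
    and "\<And>z. z \<in> ball 0 1 \<Longrightarrow> (norm (l - f z))\<^sup>2 \<le> C * (norm (\<sigma> - z))\<^sup>2 * defect_ratio f z"
proof -
  let ?G = "inf (at \<sigma> within ball 0 1) (principal {z. defect_ratio f z \<le> C})"
  have "?G \<noteq> bot"
    using freq by (simp add: frequently_def trivial_limit_def eventually_inf_principal)
  moreover have ev: "\<forall>\<^sub>F z in ?G. z \<in> ball 0 1 \<and> defect_ratio f z \<le> C"
    unfolding eventually_inf_principal using eventually_in_disc by eventually_elim simp
  then have "\<forall>\<^sub>F z in ?G. f z \<in> cball 0 1"
    by eventually_elim (use im in force)
  ultimately obtain l where l: "inf (nhds l) (filtermap f ?G) \<noteq> bot"
    using compact_cball[of "0::complex" 1, unfolded compact_filter, rule_format, of "filtermap f ?G"]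
    by (auto simp: eventually_filtermap filtermap_bot_iff)
  \<comment> \<open>\<open>H\<close> plays the role of a subsequence along which \<open>f\<close> converges to the cluster point \<open>l\<close>.\<close>
  define H where "H = inf ?G (filtercomap f (nhds l))"
  have H: "H \<noteq> bot"
  proof
    assume "H = bot"
    then have "eventually (\<lambda>_. False) H" by simp
    then obtain P Q where PQ: "eventually P ?G" "eventually Q (nhds l)" "\<And>x. P x \<Longrightarrow> Q (f x) \<Longrightarrow> False"
      unfolding H_def eventually_inf[of _ ?G] eventually_filtercomap by blast
    then have "eventually (\<lambda>y. \<not> Q y) (filtermap f ?G)"
      using PQ(1,3) unfolding eventually_filtermap by (auto elim!: eventually_mono)
    with PQ(2) have "eventually (\<lambda>_. False) (inf (nhds l) (filtermap f ?G))"
      unfolding eventually_inf by blast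
    with l show False by (simp add: trivial_limit_def)
  qed
  have HG: "H \<le> ?G" unfolding H_def by (rule inf_le1)
  have "H \<le> filtercomap f (nhds l)" unfolding H_def by simp
  then have fl: "(f \<longlongrightarrow> l) H"
    by (simp add: filterlim_def filtermap_le_iff_le_filtercomap)
  have id: "((\<lambda>\<zeta>. \<zeta>) \<longlongrightarrow> \<sigma>) H"
    using HG by (intro tendsto_mono[OF _ tendsto_ident_at[of \<sigma> "ball 0 1"]]) simp
  have "((\<lambda>z. norm (f z)) \<longlongrightarrow> 1) ?G"
    using \<sigma> eventually_in_disc[of \<sigma>] im
    by (intro norm_tendsto_1_if_defect_ratio_bounded) (auto elim!: eventually_mono simp: image_subset_iff less_imp_le)
  then have "((\<lambda>z. norm (f z)) \<longlongrightarrow> 1) H"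
    using HG by (rule tendsto_mono[rotated])
  from tendsto_unique[OF H tendsto_norm[OF fl] this] have norm_l: "norm l = 1" .
  have "(norm (l - f z))\<^sup>2 \<le> C * (norm (\<sigma> - z))\<^sup>2 * defect_ratio f z" if z: "z \<in> ball 0 1" for z
  proof -
    have "(norm (1 - cnj l * f z))\<^sup>2 \<le> C * ((norm (1 - cnj \<sigma> * z))\<^sup>2 * defect_ratio f z)"
    proof (rule tendsto_le[OF H])
      show "((\<lambda>\<zeta>. (norm (1 - cnj (f \<zeta>) * f z))\<^sup>2) \<longlongrightarrow> (norm (1 - cnj l * f z))\<^sup>2) H"
        by (intro tendsto_intros fl)
      show "((\<lambda>\<zeta>. C * ((norm (1 - cnj \<zeta> * z))\<^sup>2 * defect_ratio f z)) \<longlongrightarrow>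
            C * ((norm (1 - cnj \<sigma> * z))\<^sup>2 * defect_ratio f z)) H"
        by (intro tendsto_intros id)
      have "\<forall>\<^sub>F \<zeta> in H. \<zeta> \<in> ball 0 1 \<and> defect_ratio f \<zeta> \<le> C"
        using ev HG by (rule filter_leD[rotated])
      then show "\<forall>\<^sub>F \<zeta> in H. (norm (1 - cnj (f \<zeta>) * f z))\<^sup>2
          \<le> C * ((norm (1 - cnj \<zeta> * z))\<^sup>2 * defect_ratio f z)"
      proof eventually_elim
        case (elim \<zeta>)
        have pos: "0 < 1 - (norm z)\<^sup>2" "0 < 1 - (norm \<zeta>)\<^sup>2" "0 < 1 - (norm (f z))\<^sup>2"
          using one_minus_norm_square_pos z elim im by blast+
        then have "0 \<le> (norm (1 - cnj \<zeta> * z))\<^sup>2 * defect_ratio f z" 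
          by (simp add: defect_ratio_def)
        have "(norm (1 - cnj (f \<zeta>) * f z))\<^sup>2 \<le> (norm (1 - cnj \<zeta> * z))\<^sup>2 *
            ((1 - (norm (f \<zeta>))\<^sup>2) * (1 - (norm (f z))\<^sup>2)) / ((1 - (norm \<zeta>)\<^sup>2) * (1 - (norm z)\<^sup>2))"
          using Schwarz_Pick_defect_form[OF holf im z, of \<zeta>] elim pos
          by (simp only: pos_le_divide_eq mult_pos_pos)
        also have "\<dots> = defect_ratio f \<zeta> * ((norm (1 - cnj \<zeta> * z))\<^sup>2 * defect_ratio f z)"
          by (simp add: defect_ratio_def mult_ac)
        also have "\<dots> \<le> C * ((norm (1 - cnj \<zeta> * z))\<^sup>2 * defect_ratio f z)"
          using elim \<open>0 \<le> _\<close> by (intro mult_right_mono) auto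
        finally show ?case .
      qed
    qed
    then show ?thesis
      using norm_l \<sigma> by (simp add: norm_one_minus_cnj_mult_sphere mult.assoc)
  qed
  with norm_l show thesis by (rule that)
qed


section \<open>Boundary values\<close>

text \<open>
  This convergence is not restricted to Stolz regions: a bound on the defect ratio replaces
  non-tangential approach.
\<close>
lemma tendsto_if_defect_ratio_bounded:
  assumes im: "f ` ball 0 1 \<subseteq> ball 0 1"
    and Julia: "\<And>z. z \<in> ball 0 1 \<Longrightarrow> (norm (l - f z))\<^sup>2 \<le> K * (norm (\<sigma> - z))\<^sup>2 * defect_ratio f z"
  shows "(f \<longlongrightarrow> l) (inf (at \<sigma> within ball 0 1) (principal {z. defect_ratio f z \<le> C}))"
    (is "(_ \<longlongrightarrow> _) ?G")
proof -
  have id: "((\<lambda>z. z) \<longlongrightarrow> \<sigma>) ?G"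
    by (rule tendsto_mono[OF _ tendsto_ident_at]) (rule inf_le1)
  have "((\<lambda>z. (norm (\<sigma> - z))\<^sup>2) \<longlongrightarrow> (norm (\<sigma> - \<sigma>))\<^sup>2) ?G"
    by (intro tendsto_intros id)
  then have "((\<lambda>z. (norm (\<sigma> - z))\<^sup>2) \<longlongrightarrow> 0) ?G" by simp
  then have "((\<lambda>z. (norm (l - f z))\<^sup>2) \<longlongrightarrow> 0) ?G"
  proof (rule tendsto_0_le)
    show "\<forall>\<^sub>F z in ?G. norm ((norm (l - f z))\<^sup>2) \<le> norm ((norm (\<sigma> - z))\<^sup>2) * (\<bar>K\<bar> * C)"
      unfolding eventually_inf_principal using eventually_in_disc
    proof eventually_elim
      case (elim z)
      have "0 \<le> defect_ratio f z"
        using im elim by (intro defect_ratio_nonneg) (auto simp: image_subset_iff less_imp_le)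
      then have "K * (norm (\<sigma> - z))\<^sup>2 * defect_ratio f z \<le> \<bar>K\<bar> * (norm (\<sigma> - z))\<^sup>2 * C"
        if "defect_ratio f z \<le> C"
        using that by (intro mult_mono) auto
      with Julia[OF elim] show ?case by (auto simp: mult_ac)
    qed
  qed
  from tendsto_real_sqrt[OF this] have "((\<lambda>z. norm (l - f z)) \<longlongrightarrow> 0) ?G" by simp
  then show ?thesis
    by (simp add: tendsto_iff dist_norm norm_minus_commute)
qed

text \<open>
  The defect ratio is at most \<open>2 \<bar>l - f(z)\<bar> / (1 - \<bar>z\<bar>)\<close>. Inserted into Julia's inequality, it cancels
  one factor \<open>\<bar>l - f(z)\<bar>\<close>, and the Stolz condition absorbs \<open>\<bar>\<sigma> - z\<bar> / (1 - \<bar>z\<bar>)\<close>, which leaves an estimate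
  that is linear in \<open>\<bar>\<sigma> - z\<bar>\<close>.
\<close>
lemma has_nontangential_limit_if_Julia:
  assumes im: "f ` ball 0 1 \<subseteq> ball 0 1" and l: "norm l = 1"
    and Julia: "\<And>z. z \<in> ball 0 1 \<Longrightarrow> (norm (l - f z))\<^sup>2 \<le> K * (norm (\<sigma> - z))\<^sup>2 * defect_ratio f z"
  shows "has_nontangential_limit f \<sigma> l"
  unfolding has_nontangential_limit_def
proof (intro allI impI)
  fix M :: real assume "M > 1"
  let ?G = "at \<sigma> within stolz_region \<sigma> M"
  have "((\<lambda>z. \<sigma> - z) \<longlongrightarrow> \<sigma> - \<sigma>) ?G"
    by (intro tendsto_intros)
  then have "((\<lambda>z. \<sigma> - z) \<longlongrightarrow> 0) ?G" by simp
  then have "((\<lambda>z. f z - l) \<longlongrightarrow> 0) ?G"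
  proof (rule tendsto_0_le)
    have "norm (f z - l) \<le> norm (\<sigma> - z) * (2 * \<bar>K\<bar> * M)" if "z \<in> stolz_region \<sigma> M" for z
    proof -
      from that have z: "z \<in> ball 0 1" and stolz: "norm (\<sigma> - z) \<le> M * (1 - norm z)"
        by (auto simp: stolz_region_def)
      let ?d = "norm (l - f z)" and ?e = "norm (\<sigma> - z)"
      have fz: "norm (f z) < 1" using im z by (auto simp: image_subset_iff)
      have "1 - (norm (f z))\<^sup>2 = (1 - norm (f z)) * (1 + norm (f z))"
        by (simp add: power2_eq_square algebra_simps)
      also have "\<dots> \<le> ?d * 2"
        using fz l norm_triangle_ineq2[of l "f z"] by (intro mult_mono) auto
      finally have num: "1 - (norm (f z))\<^sup>2 \<le> ?d * 2" .
      have den: "1 - norm z \<le> 1 - (norm z)\<^sup>2"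
        using z by (simp add: power2_eq_square mult_left_le)
      have ratio: "defect_ratio f z \<le> ?d * 2 / (1 - norm z)"
        unfolding defect_ratio_def using num den z by (intro frac_le) auto
      have "0 \<le> defect_ratio f z"
        using z fz by (intro defect_ratio_nonneg) auto
      then have "?d\<^sup>2 \<le> \<bar>K\<bar> * ?e\<^sup>2 * defect_ratio f z"
        using Julia[OF z] by (meson abs_ge_self mult_right_mono order_trans zero_le_power2)
      also have "\<dots> \<le> \<bar>K\<bar> * ?e\<^sup>2 * (?d * 2 / (1 - norm z))"
        using ratio by (intro mult_left_mono) auto
      also have "\<dots> = (2 * \<bar>K\<bar> * ?e * ?d) * (?e / (1 - norm z))"
        by (simp add: power2_eq_square)
      also have "\<dots> \<le> (2 * \<bar>K\<bar> * ?e * ?d) * M"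
        using stolz z by (intro mult_left_mono) (auto simp: divide_le_eq)
      finally have "?d * ?d \<le> ?d * (?e * (2 * \<bar>K\<bar> * M))"
        by (simp add: power2_eq_square mult_ac)
      moreover have "0 \<le> ?e * (2 * \<bar>K\<bar> * M)" using \<open>M > 1\<close> by simp
      ultimately have "?d \<le> ?e * (2 * \<bar>K\<bar> * M)"
        by (cases "?d = 0") (auto simp: mult_le_cancel_left_pos)
      then show ?thesis by (simp add: norm_minus_commute)
    qed
    then show "\<forall>\<^sub>F z in ?G. norm (f z - l) \<le> norm (\<sigma> - z) * (2 * \<bar>K\<bar> * M)"
      by (simp add: eventually_at_filter)
  qed
  then show "(f \<longlongrightarrow> l) ?G" by (rule LIM_zero_cancel)
qed

text \<open>The radius ending at \<open>\<sigma>\<close> lies in every Stolz region; this makes the limit unique.\<close>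
lemma at_within_stolz_region_nontrivial:
  assumes \<sigma>: "\<sigma> \<in> sphere 0 1" and "M > 1"
  shows "at \<sigma> within stolz_region \<sigma> M \<noteq> bot"
  unfolding trivial_limit_within not_not islimpt_approachable
proof (intro allI impI)
  fix e :: real assume "0 < e"
  define t where "t = min (1/2) (e/2)"
  have t: "0 < t" "t < 1" "t < e" using \<open>0 < e\<close> by (auto simp: t_def)
  define x where "x = of_real (1 - t) * \<sigma>"
  have "norm x = 1 - t" using \<sigma> t by (simp add: x_def norm_mult del: of_real_diff)
  moreover have "\<sigma> - x = of_real t * \<sigma>" by (simp add: x_def algebra_simps)
  then have "norm (\<sigma> - x) = t" using \<sigma> t by (simp add: norm_mult)
  ultimately have "x \<in> stolz_region \<sigma> M" "x \<noteq> \<sigma>" "dist x \<sigma> < e"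
    using t \<sigma> \<open>M > 1\<close> by (auto simp: stolz_region_def dist_norm norm_minus_commute)
  then show "\<exists>x\<in>stolz_region \<sigma> M. x \<noteq> \<sigma> \<and> dist x \<sigma> < e" by blast
qed

lemma nontangential_limit_eqI:
  assumes "\<sigma> \<in> sphere 0 1" "has_nontangential_limit f \<sigma> l"
  shows "nontangential_limit f \<sigma> = l"
  unfolding nontangential_limit_def
proof (rule the_equality)
  fix l' assume "has_nontangential_limit f \<sigma> l'"
  with assms(2) have "(f \<longlongrightarrow> l') (at \<sigma> within stolz_region \<sigma> 2)" "(f \<longlongrightarrow> l) (at \<sigma> within stolz_region \<sigma> 2)"
    by (auto simp: has_nontangential_limit_def)
  then show "l' = l"
    using at_within_stolz_region_nontrivial[OF assms(1), of 2] by (auto intro: tendsto_unique)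
qed (fact assms(2))

section \<open>The hyperbolic difference quotient\<close>

lemma norm_hyperbolic_quotient:
  assumes "z \<noteq> w"
  shows "norm (hyperbolic_quotient f w z) =
    norm ((f z - f w) / (1 - cnj (f w) * f z)) / norm ((z - w) / (1 - cnj w * z))"
  using assms by (simp only: hyperbolic_quotient_def if_False norm_divide)

lemma norm_hyperbolic_quotient_le_1:
  assumes "f holomorphic_on ball 0 1" "f ` ball 0 1 \<subseteq> ball 0 1"
    and "z \<in> ball 0 1" "w \<in> ball 0 1" "z \<noteq> w"
  shows "norm (hyperbolic_quotient f w z) \<le> 1"
proof -
  have "norm ((z - w) / (1 - cnj w * z)) > 0"
    using assms one_minus_cnj_mult_nonzero[of w z] by simp
  then show ?thesis
    unfolding norm_hyperbolic_quotient[OF assms(5)]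
    using Schwarz_Pick[OF assms(1-4)] by (simp only: divide_le_eq_1_pos)
qed

text \<open>
  With \<open>P\<close> and \<open>T\<close> the pseudo-hyperbolic distances of the images and of the points, the quotient has
  modulus \<open>P / T\<close>. So \<open>T\<^sup>2 (1 - (P / T)\<^sup>2) = (1 - P\<^sup>2) - (1 - T\<^sup>2)\<close>, and the disc automorphism
  identity evaluates both differences.
\<close>
lemma defect_ratio_hyperbolic_quotient:
  assumes im: "f ` ball 0 1 \<subseteq> ball 0 1"
    and z: "z \<in> ball 0 1" and w: "w \<in> ball 0 1" and "z \<noteq> w"
  shows "(norm (z - w) / norm (1 - cnj w * z))\<^sup>2 * defect_ratio (hyperbolic_quotient f w) z =
      (1 - (norm (f w))\<^sup>2) / (norm (1 - cnj (f w) * f z))\<^sup>2 * defect_ratio f z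
      - (1 - (norm w)\<^sup>2) / (norm (1 - cnj w * z))\<^sup>2"
proof -
  let ?p = "norm (1 - cnj (f w) * f z)" and ?q = "norm (1 - cnj w * z)"
  let ?P = "norm (f z - f w) / ?p" and ?T = "norm (z - w) / ?q"
  have fz: "f z \<in> ball 0 1" and fw: "f w \<in> ball 0 1" using im z w by blast+
  have p: "?p \<noteq> 0" and q: "?q \<noteq> 0"
    using one_minus_cnj_mult_nonzero[OF fw, of "f z"] one_minus_cnj_mult_nonzero[OF w, of z] fz z by auto
  have T: "?T \<noteq> 0" using \<open>z \<noteq> w\<close> q by simp
  have d: "1 - (norm z)\<^sup>2 \<noteq> 0" using one_minus_norm_square_pos[OF z] by simp
  have "norm (hyperbolic_quotient f w z) = ?P / ?T"
    unfolding norm_hyperbolic_quotient[OF \<open>z \<noteq> w\<close>] norm_divide ..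
  then have "?T\<^sup>2 * (1 - (norm (hyperbolic_quotient f w z))\<^sup>2) = ?T\<^sup>2 - ?P\<^sup>2"
    using T by (simp only: power_divide[of ?P ?T] right_diff_distrib) simp
  also have "\<dots> = (1 - ?P\<^sup>2) - (1 - ?T\<^sup>2)" by simp
  also have "1 - ?P\<^sup>2 = (1 - (norm (f w))\<^sup>2) * (1 - (norm (f z))\<^sup>2) / ?p\<^sup>2"
    unfolding disc_automorphism_identity[of "f w" "f z", symmetric] using p
    by (simp add: power_divide diff_divide_distrib)
  also have "1 - ?T\<^sup>2 = (1 - (norm w)\<^sup>2) * (1 - (norm z)\<^sup>2) / ?q\<^sup>2"
    unfolding disc_automorphism_identity[of w z, symmetric] using q
    by (simp add: power_divide diff_divide_distrib)
  finally have "?T\<^sup>2 * defect_ratio (hyperbolic_quotient f w) z =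
     ((1 - (norm (f w))\<^sup>2) * (1 - (norm (f z))\<^sup>2) / ?p\<^sup>2 - (1 - (norm w)\<^sup>2) * (1 - (norm z)\<^sup>2) / ?q\<^sup>2)
      / (1 - (norm z)\<^sup>2)"
    unfolding defect_ratio_def times_divide_eq_right by (rule arg_cong)
  also have "\<dots> = (1 - (norm (f w))\<^sup>2) / ?p\<^sup>2 * defect_ratio f z - (1 - (norm w)\<^sup>2) / ?q\<^sup>2"
    unfolding defect_ratio_def by (subst diff_divide_distrib) (use d in simp)
  finally show ?thesis .
qed


text \<open>
  The preceding identity, solved for the defect ratio of \<open>f\<close> and estimated with constants independent of
  \<open>z\<close>: \<open>\<bar>1 - cnj (f(w)) * f(z)\<bar> \<le> 2\<close>, \<open>\<bar>1 - cnj w * z\<bar> \<ge> 1 - \<bar>w\<bar>\<close>, and the pseudo-hyperbolic distance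
  of \<open>z\<close> and \<open>w\<close> is at most \<open>1\<close>.
\<close>
lemma defect_ratio_le_hyperbolic_quotient:
  assumes holf: "f holomorphic_on ball 0 1" and im: "f ` ball 0 1 \<subseteq> ball 0 1"
    and z: "z \<in> ball 0 1" and w: "w \<in> ball 0 1" and "z \<noteq> w"
  shows "defect_ratio f z \<le> 4 / (1 - (norm (f w))\<^sup>2) *
    (defect_ratio (hyperbolic_quotient f w) z + (1 - (norm w)\<^sup>2) / (1 - norm w)\<^sup>2)"
proof -
  let ?p = "norm (1 - cnj (f w) * f z)" and ?q = "norm (1 - cnj w * z)"
  let ?T = "norm (z - w) / ?q" and ?A = "1 - (norm (f w))\<^sup>2" and ?B = "1 - (norm w)\<^sup>2"
  let ?g = "hyperbolic_quotient f w"
  have fz: "f z \<in> ball 0 1" and fw: "f w \<in> ball 0 1" using im z w by blast+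
  note pos = one_minus_norm_square_pos[OF z] one_minus_norm_square_pos[OF w]
    one_minus_norm_square_pos[OF fz] one_minus_norm_square_pos[OF fw]
  have nonneg: "0 \<le> defect_ratio f z" "0 \<le> defect_ratio ?g z"
    using z fz norm_hyperbolic_quotient_le_1[OF holf im z w \<open>z \<noteq> w\<close>]
    by (auto intro!: defect_ratio_nonneg)
  have p0: "0 < ?p" and q0: "0 < ?q"
    using one_minus_cnj_mult_nonzero[OF fw, of "f z"] one_minus_cnj_mult_nonzero[OF w, of z] fz z by auto
  have "?p \<le> norm (1::complex) + norm (cnj (f w) * f z)" by (rule norm_triangle_ineq4)
  also have "\<dots> \<le> 1 + 1 * 1"
    unfolding norm_mult complex_mod_cnj norm_one using fz fw by (intro add_mono mult_mono) auto
  finally have "?p\<^sup>2 \<le> 2\<^sup>2" by (intro power_mono) auto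
  then have "?A / 4 \<le> ?A / ?p\<^sup>2"
    using pos p0 by (intro divide_left_mono) auto
  then have "?A / 4 * defect_ratio f z \<le> ?A / ?p\<^sup>2 * defect_ratio f z"
    using nonneg(1) by (rule mult_right_mono)
  also have "\<dots> = ?T\<^sup>2 * defect_ratio ?g z + ?B / ?q\<^sup>2"
    using defect_ratio_hyperbolic_quotient[OF im z w \<open>z \<noteq> w\<close>] by simp
  also have "\<dots> \<le> 1 * defect_ratio ?g z + ?B / (1 - norm w)\<^sup>2"
  proof (intro add_mono mult_right_mono nonneg)
    have "(norm (z - w))\<^sup>2 \<le> ?q\<^sup>2"
      using disc_automorphism_identity[of w z] pos by (smt (verit) mult_pos_pos)
    then show "?T\<^sup>2 \<le> 1" using q0 by (simp add: power_divide)
    have "norm w * norm z \<le> norm w * 1" using z by (intro mult_left_mono) auto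
    then have "1 - norm w \<le> ?q"
      using norm_triangle_ineq2[of 1 "cnj w * z"] by (simp add: norm_mult)
    then show "?B / ?q\<^sup>2 \<le> ?B / (1 - norm w)\<^sup>2"
      using w pos by (intro divide_left_mono power_mono mult_pos_pos zero_less_power q0) auto
  qed
  finally show ?thesis using pos by (simp add: field_simps)
qed

lemma defect_ratio_bounded_if_hyperbolic_quotient_bounded:
  assumes holf: "f holomorphic_on ball 0 1" and im: "f ` ball 0 1 \<subseteq> ball 0 1"
    and w: "w \<in> ball 0 1"
  obtains C' where "\<forall>\<^sub>F z in at \<sigma> within ball 0 1.
    defect_ratio (hyperbolic_quotient f w) z \<le> C \<longrightarrow> defect_ratio f z \<le> C'"
proof -
  let ?K = "4 / (1 - (norm (f w))\<^sup>2)" and ?B = "(1 - (norm w)\<^sup>2) / (1 - norm w)\<^sup>2"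
  have "?K \<ge> 0"
    using one_minus_norm_square_pos[of "f w"] im w by (auto simp: image_subset_iff)
  have "\<forall>\<^sub>F z in at \<sigma> within ball 0 1.
      defect_ratio (hyperbolic_quotient f w) z \<le> C \<longrightarrow> defect_ratio f z \<le> ?K * (C + ?B)"
    using eventually_in_disc eventually_neq_at_within[of w]
  proof eventually_elim
    case (elim z)
    show ?case
    proof
      assume "defect_ratio (hyperbolic_quotient f w) z \<le> C"
      then have "?K * (defect_ratio (hyperbolic_quotient f w) z + ?B) \<le> ?K * (C + ?B)"
        using \<open>?K \<ge> 0\<close> by (intro mult_left_mono) auto
      with defect_ratio_le_hyperbolic_quotient[OF holf im elim(1) w elim(2)]
      show "defect_ratio f z \<le> ?K * (C + ?B)" by (rule order_trans)
    qed
  qed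
  then show thesis by (rule that)
qed

lemma boundary_dilation_hyperbolic_quotient_eq_Liminf:
  assumes "f holomorphic_on ball 0 1" "f ` ball 0 1 \<subseteq> ball 0 1"
    and "\<sigma> \<in> sphere 0 1" "w \<in> ball 0 1"
  shows "boundary_dilation (hyperbolic_quotient f w) \<sigma> =
    Liminf (at \<sigma> within ball 0 1) (\<lambda>z. ereal (defect_ratio (hyperbolic_quotient f w) z))"
proof (rule boundary_dilation_eq_Liminf_defect_ratio[OF assms(3)])
  show "\<forall>\<^sub>F z in at \<sigma> within ball 0 1. norm (hyperbolic_quotient f w z) \<le> 1"
    using eventually_in_disc eventually_neq_at_within[of w]
    by eventually_elim (use norm_hyperbolic_quotient_le_1 assms in blast)
qed

lemma boundary_dilation_self_map_eq_Liminf: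
  assumes "f ` ball 0 1 \<subseteq> ball 0 1" and "\<sigma> \<in> sphere 0 1"
  shows "boundary_dilation f \<sigma> = Liminf (at \<sigma> within ball 0 1) (\<lambda>z. ereal (defect_ratio f z))"
proof (rule boundary_dilation_eq_Liminf_defect_ratio[OF assms(2)])
  show "\<forall>\<^sub>F z in at \<sigma> within ball 0 1. norm (f z) \<le> 1"
    using eventually_in_disc
    by eventually_elim (use assms(1) in \<open>force simp: image_subset_iff\<close>)
qed

lemma boundary_dilation_finite_if_hyperbolic_quotient_finite:
  assumes holf: "f holomorphic_on ball 0 1" and im: "f ` ball 0 1 \<subseteq> ball 0 1"
    and \<sigma>: "\<sigma> \<in> sphere 0 1" and w: "w \<in> ball 0 1"
    and fin: "boundary_dilation (hyperbolic_quotient f w) \<sigma> < \<infinity>"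
  shows "boundary_dilation f \<sigma> < \<infinity>"
proof -
  let ?g = "hyperbolic_quotient f w"
  obtain C where C: "\<exists>\<^sub>F z in at \<sigma> within ball 0 1. defect_ratio ?g z \<le> C"
    using fin unfolding boundary_dilation_hyperbolic_quotient_eq_Liminf[OF assms(1-4)]
      Liminf_less_PInfty_iff by blast
  obtain C' where "\<forall>\<^sub>F z in at \<sigma> within ball 0 1. defect_ratio ?g z \<le> C \<longrightarrow> defect_ratio f z \<le> C'"
    using holf im w by (rule defect_ratio_bounded_if_hyperbolic_quotient_bounded)
  with C have "\<exists>\<^sub>F z in at \<sigma> within ball 0 1. defect_ratio f z \<le> C'"
    by (rule frequently_rev_mp)
  then show ?thesis
    unfolding boundary_dilation_self_map_eq_Liminf[OF im \<sigma>] Liminf_less_PInfty_iff by blast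
qed

text \<open>
  The coefficients of the identity for the defect ratios converge where the defect ratio of \<open>f\<close> is
  bounded: the one containing \<open>f(z)\<close> by Julia's inequality, the others by continuity. There the defect ratio
  of the quotient is asymptotically the affine function with slope \<open>a\<close> and offset \<open>-b\<close> of that of \<open>f\<close>,
  and this function commutes with the lower limit because \<open>a\<close> is positive.
\<close>
lemma boundary_dilation_hyperbolic_quotient:
  assumes holf: "f holomorphic_on ball 0 1" and im: "f ` ball 0 1 \<subseteq> ball 0 1"
    and \<sigma>: "\<sigma> \<in> sphere 0 1" and w: "w \<in> ball 0 1"
    and fin: "boundary_dilation f \<sigma> < \<infinity>"
  shows "boundary_dilation (hyperbolic_quotient f w) \<sigma> =
    boundary_dilation f \<sigma> *
      ereal ((1 - (norm (f w))\<^sup>2) / (norm (nontangential_limit f \<sigma> - f w))\<^sup>2)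
    - ereal ((1 - (norm w)\<^sup>2) / (norm (\<sigma> - w))\<^sup>2)"
proof -
  let ?F = "at \<sigma> within ball 0 1" and ?g = "hyperbolic_quotient f w"
  obtain C\<^sub>0 where C\<^sub>0: "\<exists>\<^sub>F z in ?F. defect_ratio f z \<le> C\<^sub>0"
    using fin unfolding boundary_dilation_self_map_eq_Liminf[OF im \<sigma>] Liminf_less_PInfty_iff by blast
  obtain l where l: "norm l = 1"
    and Julia: "\<And>z. z \<in> ball 0 1 \<Longrightarrow> (norm (l - f z))\<^sup>2 \<le> C\<^sub>0 * (norm (\<sigma> - z))\<^sup>2 * defect_ratio f z"
    using Julia_inequality[OF holf im \<sigma> C\<^sub>0] by blast
  have lim: "nontangential_limit f \<sigma> = l"
    using \<sigma> has_nontangential_limit_if_Julia[OF im l Julia] by (rule nontangential_limit_eqI)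
  have fw: "f w \<in> ball 0 1" using im w by blast
  define a where "a = (1 - (norm (f w))\<^sup>2) / (norm (l - f w))\<^sup>2"
  define b where "b = (1 - (norm w)\<^sup>2) / (norm (\<sigma> - w))\<^sup>2"
  have "l \<noteq> f w" "\<sigma> \<noteq> w" using l fw \<sigma> w by auto
  then have "a > 0"
    unfolding a_def using one_minus_norm_square_pos[OF fw] by simp
  have swap: "norm (1 - cnj x * y) = norm (y - x)" if "norm y = 1" for x y :: complex
  proof -
    have "norm (1 - cnj x * y) = norm (cnj (1 - cnj x * y))" by (rule complex_mod_cnj[symmetric])
    then show ?thesis using norm_one_minus_cnj_mult_sphere[OF that, of x] by (simp add: mult.commute)
  qed
  have "Liminf ?F (\<lambda>z. ereal (defect_ratio ?g z)) = Liminf ?F (\<lambda>z. ereal (defect_ratio f z * a - b))"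
  proof (rule Liminf_eq_if_close_on_sublevels)
    fix C
    let ?C = "(C + b) / a"
    let ?G = "inf ?F (principal {z. defect_ratio f z \<le> ?C})"
    define T where "T z = (norm (z - w) / norm (1 - cnj w * z))\<^sup>2" for z
    define A where "A z = (1 - (norm (f w))\<^sup>2) / (norm (1 - cnj (f w) * f z))\<^sup>2" for z
    define B where "B z = (1 - (norm w)\<^sup>2) / (norm (1 - cnj w * z))\<^sup>2" for z
    have G: "{z. defect_ratio f z * a - b \<le> C} = {z. defect_ratio f z \<le> ?C}"
      using \<open>a > 0\<close> by (auto simp: field_simps)
    have id: "((\<lambda>z. z) \<longlongrightarrow> \<sigma>) ?G"
      by (rule tendsto_mono[OF _ tendsto_ident_at]) (rule inf_le1)
    have fl: "(f \<longlongrightarrow> l) ?G"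
      using im Julia by (rule tendsto_if_defect_ratio_bounded)
    have \<sigma>w: "norm (1 - cnj w * \<sigma>) = norm (\<sigma> - w)" using \<sigma> by (intro swap) simp
    have "(T \<longlongrightarrow> (norm (\<sigma> - w) / norm (1 - cnj w * \<sigma>))\<^sup>2) ?G"
      unfolding T_def using \<open>\<sigma> \<noteq> w\<close> \<sigma>w by (intro tendsto_intros id) auto
    then have T: "(T \<longlongrightarrow> 1) ?G" using \<open>\<sigma> \<noteq> w\<close> by (simp add: \<sigma>w)
    have "(A \<longlongrightarrow> (1 - (norm (f w))\<^sup>2) / (norm (1 - cnj (f w) * l))\<^sup>2) ?G"
      unfolding A_def using \<open>l \<noteq> f w\<close> swap[OF l, of "f w"] by (intro tendsto_intros fl) auto
    then have A: "(A \<longlongrightarrow> a) ?G" by (simp add: a_def swap[OF l])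
    have "(B \<longlongrightarrow> (1 - (norm w)\<^sup>2) / (norm (1 - cnj w * \<sigma>))\<^sup>2) ?G"
      unfolding B_def using \<open>\<sigma> \<noteq> w\<close> \<sigma>w by (intro tendsto_intros id) auto
    then have B: "(B \<longlongrightarrow> b) ?G" by (simp add: b_def \<sigma>w)
    have "((\<lambda>z. A z / T z - a) \<longlongrightarrow> a / 1 - a) ?G"
      by (intro tendsto_intros A T) simp
    then have "((\<lambda>z. A z / T z - a) \<longlongrightarrow> 0) ?G" by simp
    then have 1: "((\<lambda>z. (A z / T z - a) * defect_ratio f z) \<longlongrightarrow> 0) ?G"
    proof (rule tendsto_0_le)
      show "\<forall>\<^sub>F z in ?G. norm ((A z / T z - a) * defect_ratio f z) \<le> norm (A z / T z - a) * ?C"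
        unfolding eventually_inf_principal using eventually_in_disc
      proof eventually_elim
        case (elim z)
        have "0 \<le> defect_ratio f z"
          using im elim by (intro defect_ratio_nonneg) (auto simp: image_subset_iff less_imp_le)
        then show ?case
          unfolding norm_mult by (auto intro!: mult_left_mono simp del: times_divide_eq_right)
      qed
    qed
    have "((\<lambda>z. (A z / T z - a) * defect_ratio f z - (B z / T z - b)) \<longlongrightarrow> 0 - (b / 1 - b)) ?G"
      by (intro tendsto_intros 1 B T) simp
    then have "((\<lambda>z. (A z / T z - a) * defect_ratio f z - (B z / T z - b)) \<longlongrightarrow> 0) ?G" by simp
    moreover have "\<forall>\<^sub>F z in ?G. (A z / T z - a) * defect_ratio f z - (B z / T z - b)
        = defect_ratio ?g z - (defect_ratio f z * a - b)"
    proof -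
      have "\<forall>\<^sub>F z in ?F. (A z / T z - a) * defect_ratio f z - (B z / T z - b)
        = defect_ratio ?g z - (defect_ratio f z * a - b)"
        using eventually_in_disc eventually_neq_at_within[of w]
      proof eventually_elim
        case (elim z)
        have "T z \<noteq> 0"
          using one_minus_cnj_mult_nonzero[OF w, of z] elim by (simp add: T_def)
        moreover have "T z * defect_ratio ?g z = A z * defect_ratio f z - B z"
          using defect_ratio_hyperbolic_quotient[OF im elim(1) w elim(2)]
          by (simp add: T_def A_def B_def)
        ultimately have "defect_ratio ?g z = (A z * defect_ratio f z - B z) / T z"
          by (simp add: field_simps)
        then show ?case by (simp add: algebra_simps diff_divide_distrib)
      qed
      then show ?thesis by (rule filter_leD[OF inf_le1])
    qed
    ultimately show "((\<lambda>z. defect_ratio ?g z - (defect_ratio f z * a - b)) \<longlongrightarrow> 0)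
        (inf ?F (principal {z. defect_ratio f z * a - b \<le> C}))"
      unfolding G by (rule Lim_transform_eventually)
  next
    fix C
    obtain C' where "\<forall>\<^sub>F z in ?F. defect_ratio ?g z \<le> C \<longrightarrow> defect_ratio f z \<le> C'"
      using holf im w by (rule defect_ratio_bounded_if_hyperbolic_quotient_bounded)
    then have "\<forall>\<^sub>F z in ?F. defect_ratio ?g z \<le> C \<longrightarrow> defect_ratio f z * a - b \<le> C' * a - b"
      by eventually_elim (use \<open>a > 0\<close> in \<open>simp add: mult_right_mono\<close>)
    then show "\<exists>C'. \<forall>\<^sub>F z in ?F. defect_ratio ?g z \<le> C \<longrightarrow> defect_ratio f z * a - b \<le> C'" by blast
  qed
  also have "\<dots> = Liminf ?F (\<lambda>z. ereal (defect_ratio f z) * ereal a + ereal (- b))"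
    by simp
  also have "\<dots> = Liminf ?F (\<lambda>z. ereal (defect_ratio f z)) * ereal a + ereal (- b)"
    using \<open>a > 0\<close> at_sphere_within_disc_nontrivial[OF \<sigma>]
    by (subst Liminf_add_ereal_right) (simp_all add: Liminf_ereal_mult_right del: times_ereal.simps plus_ereal.simps)
  finally show ?thesis
    unfolding boundary_dilation_hyperbolic_quotient_eq_Liminf[OF holf im \<sigma> w]
      boundary_dilation_self_map_eq_Liminf[OF im \<sigma>] lim a_def[symmetric] b_def[symmetric]
    by (simp add: minus_ereal_def)
qed

theorem proposition1p4:
  fixes f :: "complex \<Rightarrow> complex" and \<sigma> :: complex
  assumes "f holomorphic_on ball 0 1"
    and "f ` ball 0 1 \<subseteq> ball 0 1"
    and "\<sigma> \<in> sphere 0 1"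
  shows "(boundary_dilation f \<sigma> < \<infinity> \<longrightarrow>
        (\<forall>w\<in>ball 0 1. boundary_dilation (hyperbolic_quotient f w) \<sigma> =
          boundary_dilation f \<sigma> *
            ereal ((1 - (norm (f w))\<^sup>2) / (norm (nontangential_limit f \<sigma> - f w))\<^sup>2)
          - ereal ((1 - (norm w)\<^sup>2) / (norm (\<sigma> - w))\<^sup>2))) \<and>
      ((\<exists>w\<^sub>0\<in>ball 0 1. boundary_dilation (hyperbolic_quotient f w\<^sub>0) \<sigma> < \<infinity>) \<longleftrightarrow>
        (\<forall>w\<in>ball 0 1. boundary_dilation (hyperbolic_quotient f w) \<sigma> < \<infinity>)) \<and>
      ((\<forall>w\<in>ball 0 1. boundary_dilation (hyperbolic_quotient f w) \<sigma> < \<infinity>) \<longleftrightarrow>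
        boundary_dilation f \<sigma> < \<infinity>)"
proof -
  have formula: "boundary_dilation (hyperbolic_quotient f w) \<sigma> =
      boundary_dilation f \<sigma> *
        ereal ((1 - (norm (f w))\<^sup>2) / (norm (nontangential_limit f \<sigma> - f w))\<^sup>2)
      - ereal ((1 - (norm w)\<^sup>2) / (norm (\<sigma> - w))\<^sup>2)"
    if "boundary_dilation f \<sigma> < \<infinity>" "w \<in> ball 0 1" for w
    using boundary_dilation_hyperbolic_quotient[OF assms that(2,1)] .
  have finite_iff: "boundary_dilation (hyperbolic_quotient f w) \<sigma> < \<infinity> \<longleftrightarrow> boundary_dilation f \<sigma> < \<infinity>"
    if w: "w \<in> ball 0 1" for w
  proof
    assume fin: "boundary_dilation f \<sigma> < \<infinity>"
    have "0 \<le> (1 - (norm (f w))\<^sup>2) / (norm (nontangential_limit f \<sigma> - f w))\<^sup>2"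
      using one_minus_norm_square_pos[of "f w"] assms(2) w by (auto simp: image_subset_iff)
    with fin show "boundary_dilation (hyperbolic_quotient f w) \<sigma> < \<infinity>"
      unfolding formula[OF fin w] by (cases "boundary_dilation f \<sigma>") auto
  qed (rule boundary_dilation_finite_if_hyperbolic_quotient_finite[OF assms w])
  have "(0::complex) \<in> ball 0 1" by simp
  with formula finite_iff show ?thesis by blast
qed

end
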